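(* For every $n\ge 0$ the Cayley-Dickson loop $Q_n$ is Hamiltonian, i.e. every subloop of $Q_n$ is normal in $Q_n$.
   Context: A loop is a nonempty set $L$ with a binary operation having a two-sided neutral element $1$ such that for all $a,b\in L$ the equations $a\cdot y=b$ and $x\cdot a=b$ have unique solutions $y,x\in L$. A subloop is a subset that is a loop under the restricted operation (same neutral element). Cayley-Dickson loops $Q_n$ are defined inductively, each with a negation $x\mapsto -x$ and a conjugation $x\mapsto x^*$. $Q_0=\{1,-1\}$ with the usual multiplication and $x^*=x$. For $n\ge 1$, $Q_n=\{(x,0),(x,1)\mid x\in Q_{n-1}\}$ with $-(x,a)=(-x,a)$, multiplication $(x,0)(y,0)=(xy,0)$, $(x,0)(y,1)=(yx,1)$, $(x,1)(y,0)=(xy^*,1)$, $(x,1)(y,1)=(-y^*x,0)$, and conjugation $(x,0)^*=(x^*,0)$, $(x,1)^*=(-x,1)$. The neutral element of $Q_n$ is $1=(1_{Q_{n-1}},0)$, and $-1$ denotes its negative. A subloop $S$ of a loop $L$ is normal if for all $x,y\in L$: $xS=Sx$, $(xS)y=x(Sy)$, and $x(yS)=(xy)S$. A loop is Hamiltonian if every subloop of it is normal. *)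

theory Defs
  imports "HOL-Algebra.Coset"
begin

text \<open>
  Loops are represented by the record type of HOL-Algebra's (associative) monoids, which supplies
  carrier, product and neutral element as well as the notation for cosets.
\<close>

definition loop :: "('a, 'b) monoid_scheme \<Rightarrow> bool" where
  "loop L \<longleftrightarrow>
     \<one>\<^bsub>L\<^esub> \<in> carrier L \<and>
     (\<forall>a\<in>carrier L. \<forall>b\<in>carrier L. a \<otimes>\<^bsub>L\<^esub> b \<in> carrier L) \<and>
     (\<forall>a\<in>carrier L. \<one>\<^bsub>L\<^esub> \<otimes>\<^bsub>L\<^esub> a = a \<and> a \<otimes>\<^bsub>L\<^esub> \<one>\<^bsub>L\<^esub> = a) \<and>
     (\<forall>a\<in>carrier L. \<forall>b\<in>carrier L. \<exists>!y. y \<in> carrier L \<and> a \<otimes>\<^bsub>L\<^esub> y = b) \<and>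
     (\<forall>a\<in>carrier L. \<forall>b\<in>carrier L. \<exists>!x. x \<in> carrier L \<and> x \<otimes>\<^bsub>L\<^esub> a = b)"

definition subloop :: "'a set \<Rightarrow> ('a, 'b) monoid_scheme \<Rightarrow> bool" where
  "subloop S L \<longleftrightarrow> S \<subseteq> carrier L \<and> loop (L\<lparr>carrier := S\<rparr>)"

definition normal_subloop :: "'a set \<Rightarrow> ('a, 'b) monoid_scheme \<Rightarrow> bool" where
  "normal_subloop S L \<longleftrightarrow>
     subloop S L \<and>
     (\<forall>x\<in>carrier L. \<forall>y\<in>carrier L.
        x <#\<^bsub>L\<^esub> S = S #>\<^bsub>L\<^esub> x \<and>
        (x <#\<^bsub>L\<^esub> S) #>\<^bsub>L\<^esub> y = x <#\<^bsub>L\<^esub> (S #>\<^bsub>L\<^esub> y) \<and>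
        x <#\<^bsub>L\<^esub> (y <#\<^bsub>L\<^esub> S) = (x \<otimes>\<^bsub>L\<^esub> y) <#\<^bsub>L\<^esub> S)"

definition hamiltonian_loop :: "('a, 'b) monoid_scheme \<Rightarrow> bool" where
  "hamiltonian_loop L \<longleftrightarrow> loop L \<and> (\<forall>S. subloop S L \<longrightarrow> normal_subloop S L)"

text \<open>
  One type holds the elements of all the Cayley-Dickson loops. The elements of the initial loop
  are \<open>Base 1\<close> and \<open>Base (-1)\<close>; in \<open>Ext x a\<close>, which stands for the pair \<open>(x, a)\<close>, the values
  \<open>False\<close> and \<open>True\<close> of \<open>a\<close> stand for 0 and 1.
\<close>

datatype cd = Base int | Ext cd bool

primrec cd_neg :: "cd \<Rightarrow> cd" where
  "cd_neg (Base a) = Base (- a)"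
| "cd_neg (Ext x a) = Ext (cd_neg x) a"

primrec cd_cnj :: "cd \<Rightarrow> cd" where
  "cd_cnj (Base a) = Base a"
| "cd_cnj (Ext x a) = (if a then Ext (cd_neg x) True else Ext (cd_cnj x) False)"

lemma size_cd_neg [simp]: "size (cd_neg x) = size x"
  by (induction x) simp_all

lemma size_cd_cnj [simp]: "size (cd_cnj x) = size x"
  by (induction x) simp_all

text \<open>
  Products of elements of different levels do not occur within a single loop and are left
  unspecified.
\<close>

function cd_mult :: "cd \<Rightarrow> cd \<Rightarrow> cd" where
  "cd_mult (Base a) (Base b) = Base (a * b)"
| "cd_mult (Ext x False) (Ext y False) = Ext (cd_mult x y) False"
| "cd_mult (Ext x False) (Ext y True) = Ext (cd_mult y x) True"
| "cd_mult (Ext x True) (Ext y False) = Ext (cd_mult x (cd_cnj y)) True"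
| "cd_mult (Ext x True) (Ext y True) = Ext (cd_mult (cd_neg (cd_cnj y)) x) False"
| "cd_mult (Base a) (Ext y d) = undefined"
| "cd_mult (Ext x c) (Base b) = undefined"
  by pat_completeness auto
termination
  by (relation "measure (\<lambda>(x, y). size x + size y)") simp_all

primrec cd_carrier :: "nat \<Rightarrow> cd set" where
  "cd_carrier 0 = {Base 1, Base (- 1)}"
| "cd_carrier (Suc n) = {Ext x a | x a. x \<in> cd_carrier n}"

primrec cd_one :: "nat \<Rightarrow> cd" where
  "cd_one 0 = Base 1"
| "cd_one (Suc n) = Ext (cd_one n) False"

definition cayley_dickson_loop :: "nat \<Rightarrow> cd monoid" where
  "cayley_dickson_loop n = \<lparr>carrier = cd_carrier n, mult = cd_mult, one = cd_one n\<rparr>"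

end

theory Submission
  imports Defs
begin

text \<open>
  Forgetting signs turns the Cayley-Dickson loop into an elementary abelian 2-group: modulo
  \<open>\<plusminus>1\<close>, conjugation is the identity, so the four clauses of the doubling
  product all reduce to \<open>(x, a)(y, b) = (xy, a + b)\<close>. The lemma \<open>grade_mult\<close>
  expresses this by a homomorphism onto bit vectors, and by \<open>eq_or_neg_if_grade_eq\<close> its
  fibres are the pairs \<open>{x, -x}\<close>. Hence \<open>xy\<close> and \<open>yx\<close>, and likewise
  \<open>(xy)z\<close> and \<open>x(yz)\<close>, differ at most by a sign.

  A subloop \<open>S\<close> other than \<open>{1}\<close> contains \<open>-1\<close>, since each
  \<open>x \<noteq> \<plusminus>1\<close> satisfies \<open>xx = -1\<close> (\<open>square_eq_neg_one\<close>).
  Then \<open>S = -S\<close> absorbs all the signs by which the two sides of a normality condition may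
  differ. The subloop \<open>{1}\<close> is normal because 1 is neutral.

  Cancellation, too, comes from the grading: if \<open>ay = az\<close> then \<open>y\<close> and
  \<open>z\<close> have the same grade, and \<open>z = -y\<close> is excluded because
  \<open>a(-y) = -(ay) \<noteq> ay\<close>. In a finite set this also makes the equations solvable.
\<close>

section \<open>Signs and conjugation\<close>

text \<open>
  Unfolded to a set comprehension, membership \<open>Ext x a \<in> cd_carrier (Suc n)\<close> leaves
  stray existential quantifiers over the truth value \<open>a\<close>; the rewrite rule below avoids them.
\<close>

declare cd_carrier.simps(2) [simp del]

lemma Ext_mem_carrier_Suc [simp]: "Ext x a \<in> cd_carrier (Suc n) \<longleftrightarrow> x \<in> cd_carrier n"
  by (simp add: cd_carrier.simps(2))

lemma carrier_SucE:
  assumes "x \<in> cd_carrier (Suc n)"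
  obtains x' a where "x = Ext x' a" "x' \<in> cd_carrier n"
  using assms by (auto simp: cd_carrier.simps(2))

lemma finite_carrier: "finite (cd_carrier n)"
proof (induction n)
  case (Suc n)
  have "cd_carrier (Suc n) = (\<lambda>(x, a). Ext x a) ` (cd_carrier n \<times> UNIV)"
    by (auto elim!: carrier_SucE)
  then show ?case
    using Suc by simp
qed simp

lemma one_closed: "cd_one n \<in> cd_carrier n"
  by (induction n) simp_all

lemma neg_closed: "x \<in> cd_carrier n \<Longrightarrow> cd_neg x \<in> cd_carrier n"
  by (induction n arbitrary: x) (auto elim!: carrier_SucE)

lemma cnj_closed: "x \<in> cd_carrier n \<Longrightarrow> cd_cnj x \<in> cd_carrier n"
  by (induction n arbitrary: x) (auto elim!: carrier_SucE simp: neg_closed)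

lemma mult_closed:
  "x \<in> cd_carrier n \<Longrightarrow> y \<in> cd_carrier n \<Longrightarrow> cd_mult x y \<in> cd_carrier n"
proof (induction n arbitrary: x y)
  case (Suc n)
  then obtain x' a y' b where "x = Ext x' a" "x' \<in> cd_carrier n" "y = Ext y' b" "y' \<in> cd_carrier n"
    by (elim carrier_SucE)
  then show ?case
    using Suc.IH by (cases a; cases b) (simp_all add: neg_closed cnj_closed)
qed auto

lemma neg_neg: "cd_neg (cd_neg x) = x"
  by (induction x) simp_all

lemma neg_neq: "x \<in> cd_carrier n \<Longrightarrow> cd_neg x \<noteq> x"
  by (induction n arbitrary: x) (auto elim!: carrier_SucE)

lemma cnj_neg: "cd_cnj (cd_neg x) = cd_neg (cd_cnj x)"
  by (induction x) simp_all

text \<open>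
  The doubling product swaps its factors, so that each of the two sign rules at one level
  depends on both at the level below.
\<close>

lemma mult_neg:
  assumes "x \<in> cd_carrier n" "y \<in> cd_carrier n"
  shows "cd_mult (cd_neg x) y = cd_neg (cd_mult x y)"
    and "cd_mult x (cd_neg y) = cd_neg (cd_mult x y)"
proof -
  have "cd_mult (cd_neg x) y = cd_neg (cd_mult x y) \<and> cd_mult x (cd_neg y) = cd_neg (cd_mult x y)"
    using assms
  proof (induction n arbitrary: x y)
    case (Suc n)
    then obtain x' a y' b
      where "x = Ext x' a" "x' \<in> cd_carrier n" "y = Ext y' b" "y' \<in> cd_carrier n"
      by (elim carrier_SucE)
    then show ?case
      using Suc.IH by (cases a; cases b) (simp_all add: neg_closed cnj_closed cnj_neg)
  qed auto
  then show "cd_mult (cd_neg x) y = cd_neg (cd_mult x y)"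
    and "cd_mult x (cd_neg y) = cd_neg (cd_mult x y)"
    by simp_all
qed

lemma cnj_one: "cd_cnj (cd_one n) = cd_one n"
  by (induction n) simp_all

lemma mult_one:
  assumes "x \<in> cd_carrier n"
  shows "cd_mult (cd_one n) x = x" and "cd_mult x (cd_one n) = x"
proof -
  have "cd_mult (cd_one n) x = x \<and> cd_mult x (cd_one n) = x"
    using assms
  proof (induction n arbitrary: x)
    case (Suc n)
    then obtain x' a where "x = Ext x' a" "x' \<in> cd_carrier n"
      by (elim carrier_SucE)
    then show ?case
      using Suc.IH by (cases a) (simp_all add: cnj_one)
  qed auto
  then show "cd_mult (cd_one n) x = x" and "cd_mult x (cd_one n) = x"
    by simp_all
qed

lemma cnj_mult_self: "x \<in> cd_carrier n \<Longrightarrow> cd_mult (cd_cnj x) x = cd_one n"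
proof (induction n arbitrary: x)
  case (Suc n)
  then obtain x' a where "x = Ext x' a" "x' \<in> cd_carrier n"
    by (elim carrier_SucE)
  then show ?case
    using Suc.IH by (cases a) (simp_all add: mult_neg[of _ n] neg_closed cnj_closed neg_neg)
qed auto

text \<open>
  An element \<open>(x, 1)\<close> squares to \<open>(-x\<^sup>* x, 0)\<close>, which is \<open>-1\<close> by
  \<open>cnj_mult_self\<close>; for \<open>(x, 0)\<close> the claim descends to \<open>x\<close>.
\<close>

lemma square_eq_neg_one:
  assumes "x \<in> cd_carrier n" "x \<noteq> cd_one n" "x \<noteq> cd_neg (cd_one n)"
  shows "cd_mult x x = cd_neg (cd_one n)"
  using assms
proof (induction n arbitrary: x)
  case (Suc n)
  obtain x' a where "x = Ext x' a" "x' \<in> cd_carrier n"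
    using Suc.prems(1) by (elim carrier_SucE)
  then show ?case
    using Suc.IH[of x'] Suc.prems(2,3)
    by (cases a) (simp_all add: mult_neg[of _ n] cnj_closed cnj_mult_self)
qed auto


section \<open>The grading by bit vectors\<close>

primrec grade :: "cd \<Rightarrow> bool list" where
  "grade (Base a) = []"
| "grade (Ext x a) = a # grade x"

lemma length_grade: "x \<in> cd_carrier n \<Longrightarrow> length (grade x) = n"
  by (induction n arbitrary: x) (auto elim!: carrier_SucE)

lemma grade_neg [simp]: "grade (cd_neg x) = grade x"
  by (induction x) simp_all

lemma grade_cnj [simp]: "grade (cd_cnj x) = grade x"
  by (induction x) simp_all

text \<open>
  Inequality of truth values is addition modulo 2.
\<close>

definition xor_list :: "bool list \<Rightarrow> bool list \<Rightarrow> bool list" where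
  "xor_list = map2 (\<noteq>)"

lemma xor_list_simps [simp]:
  "xor_list [] v = []"
  "xor_list u [] = []"
  "xor_list (a # u) (b # v) = (a \<noteq> b) # xor_list u v"
  by (simp_all add: xor_list_def)

lemma xor_list_commute: "xor_list u v = xor_list v u"
  by (induction u v rule: list_induct2') auto

lemma xor_list_assoc: "xor_list (xor_list u v) w = xor_list u (xor_list v w)"
proof (induction u arbitrary: v w)
  case (Cons a u)
  then show ?case
    by (cases v; cases w) auto
qed simp

lemma xor_list_left_cancel:
  assumes "length v = length u" "length w = length u" "xor_list u v = xor_list u w"
  shows "v = w"
  using assms
proof (induction u arbitrary: v w)
  case (Cons a u)
  obtain b v' c w' where vw: "v = b # v'" "w = c # w'"
    using Cons.prems(1,2) by (metis length_Suc_conv length_Cons)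
  have "v' = w'"
    using Cons.IH[of v' w'] Cons.prems unfolding vw by simp
  moreover have "b = c"
    using Cons.prems(3) unfolding vw by (cases a) simp_all
  ultimately show ?case
    by (simp add: vw)
qed simp

text \<open>
  Conjugation does not affect the grade, and addition of bit vectors is commutative; so neither
  the conjugates nor the order of the factors in the doubling product matter here.
\<close>

lemma grade_mult:
  "x \<in> cd_carrier n \<Longrightarrow> y \<in> cd_carrier n \<Longrightarrow>
    grade (cd_mult x y) = xor_list (grade x) (grade y)"
proof (induction n arbitrary: x y)
  case (Suc n)
  then obtain x' a y' b where "x = Ext x' a" "x' \<in> cd_carrier n" "y = Ext y' b" "y' \<in> cd_carrier n"
    by (elim carrier_SucE)
  then show ?case
    using Suc.IH
    by (cases a; cases b) (simp_all add: neg_closed cnj_closed xor_list_commute)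
qed auto

lemma eq_or_neg_if_grade_eq:
  assumes "x \<in> cd_carrier n" "y \<in> cd_carrier n" "grade x = grade y"
  shows "y = x \<or> y = cd_neg x"
  using assms
proof (induction n arbitrary: x y)
  case (Suc n)
  then obtain x' a y' b where "x = Ext x' a" "x' \<in> cd_carrier n" "y = Ext y' b" "y' \<in> cd_carrier n"
    by (elim carrier_SucE)
  then show ?case
    using Suc.IH[of x' y'] Suc.prems(3) by auto
qed auto


section \<open>The loop property\<close>

text \<open>
  This covers left and right multiplication by \<open>a\<close> at once. The grade determines the
  argument up to sign, and the sign is then determined because \<open>f\<close> commutes with negation,
  which has no fixed points.
\<close>

lemma inj_on_if_translates_grade:
  assumes a: "a \<in> cd_carrier n"
    and closed: "\<And>y. y \<in> cd_carrier n \<Longrightarrow> f y \<in> cd_carrier n"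
    and f_neg: "\<And>y. y \<in> cd_carrier n \<Longrightarrow> f (cd_neg y) = cd_neg (f y)"
    and grade_f: "\<And>y. y \<in> cd_carrier n \<Longrightarrow> grade (f y) = xor_list (grade a) (grade y)"
  shows "inj_on f (cd_carrier n)"
proof (rule inj_onI)
  fix y z
  assume mem: "y \<in> cd_carrier n" "z \<in> cd_carrier n" and eq: "f y = f z"
  have "xor_list (grade a) (grade y) = xor_list (grade a) (grade z)"
    using arg_cong[OF eq, of grade] mem by (simp add: grade_f)
  then have "grade y = grade z"
    using a mem xor_list_left_cancel[of "grade y" "grade a" "grade z"] by (simp add: length_grade)
  then consider "z = y" | "z = cd_neg y"
    using eq_or_neg_if_grade_eq mem by blast
  then show "y = z"
  proof cases
    case 2
    then have "cd_neg (f y) = f y"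
      using eq mem by (simp add: f_neg)
    then show ?thesis
      using neg_neq closed mem by blast
  qed simp
qed

lemma ex1_preimage_if_finite_inj:
  assumes "finite A" "f ` A \<subseteq> A" "inj_on f A" "b \<in> A"
  shows "\<exists>!y. y \<in> A \<and> f y = b"
proof -
  have "f ` A = A"
    using assms(1-3) by (rule endo_inj_surj)
  then have "b \<in> f ` A"
    using assms(4) by simp
  then obtain y where y: "y \<in> A" "f y = b"
    by blast
  show ?thesis
  proof (intro ex1I conjI)
    show "z = y" if "z \<in> A \<and> f z = b" for z
      using that y inj_onD[OF assms(3), of z y] by simp
  qed (fact y)+
qed

lemma loop_cayley_dickson_loop: "loop (cayley_dickson_loop n)"
proof -
  have "\<exists>!y. y \<in> cd_carrier n \<and> cd_mult a y = b"
    and "\<exists>!x. x \<in> cd_carrier n \<and> cd_mult x a = b"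
    if a: "a \<in> cd_carrier n" and b: "b \<in> cd_carrier n" for a b
  proof -
    have "inj_on (\<lambda>y. cd_mult a y) (cd_carrier n)"
      using a by (intro inj_on_if_translates_grade[of a])
        (simp_all add: mult_closed mult_neg[of _ n] grade_mult[of _ n])
    then show "\<exists>!y. y \<in> cd_carrier n \<and> cd_mult a y = b"
      using a b
      by (intro ex1_preimage_if_finite_inj finite_carrier image_subsetI mult_closed)
    have "inj_on (\<lambda>x. cd_mult x a) (cd_carrier n)"
      using a by (intro inj_on_if_translates_grade[of a])
        (simp_all add: mult_closed mult_neg[of _ n] grade_mult[of _ n] xor_list_commute)
    then show "\<exists>!x. x \<in> cd_carrier n \<and> cd_mult x a = b"
      using a b
      by (intro ex1_preimage_if_finite_inj[where f = "\<lambda>x. cd_mult x a"] finite_carrier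
          image_subsetI mult_closed)
  qed
  then show ?thesis
    by (simp add: loop_def cayley_dickson_loop_def one_closed mult_closed mult_one)
qed


section \<open>Normality of subloops\<close>

lemma neg_one_mult:
  assumes "x \<in> cd_carrier n"
  shows "cd_mult (cd_neg (cd_one n)) x = cd_neg x"
  using assms by (simp add: mult_neg[of _ n] one_closed mult_one)

lemma subloop_trivial_or_neg_closed:
  assumes "subloop S (cayley_dickson_loop n)"
  shows "S = {cd_one n} \<or> cd_neg ` S \<subseteq> S"
proof -
  have sub: "S \<subseteq> cd_carrier n" and one: "cd_one n \<in> S"
    and mult: "\<And>x y. x \<in> S \<Longrightarrow> y \<in> S \<Longrightarrow> cd_mult x y \<in> S"
    using assms by (auto simp: subloop_def loop_def cayley_dickson_loop_def)
  have "cd_neg ` S \<subseteq> S" if nontrivial: "S \<noteq> {cd_one n}"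
  proof -
    obtain x where x: "x \<in> S" "x \<noteq> cd_one n"
      using nontrivial one by blast
    have "cd_neg (cd_one n) \<in> S"
    proof (cases "x = cd_neg (cd_one n)")
      case False
      then have "cd_mult x x = cd_neg (cd_one n)"
        using x sub by (intro square_eq_neg_one) auto
      then show ?thesis
        using mult[of x x] x(1) by simp
    qed (use x in simp)
    then have "cd_neg y \<in> S" if "y \<in> S" for y
      using that mult[of "cd_neg (cd_one n)" y] subsetD[OF sub that] by (simp add: neg_one_mult)
    then show ?thesis
      by blast
  qed
  then show ?thesis
    by blast
qed

text \<open>
  A value \<open>f s\<close> agrees with \<open>g s\<close> or with \<open>-(g s) = g (-s)\<close>, and
  both are values of \<open>g\<close> on \<open>S\<close>.
\<close>

lemma image_subset_if_grade_eq:
  assumes "cd_neg ` S \<subseteq> S"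
    and "\<And>s. s \<in> S \<Longrightarrow> f s \<in> cd_carrier n"
    and "\<And>s. s \<in> S \<Longrightarrow> g s \<in> cd_carrier n"
    and "\<And>s. s \<in> S \<Longrightarrow> g (cd_neg s) = cd_neg (g s)"
    and "\<And>s. s \<in> S \<Longrightarrow> grade (f s) = grade (g s)"
  shows "f ` S \<subseteq> g ` S"
proof (rule image_subsetI)
  fix s
  assume s: "s \<in> S"
  then have "f s = g s \<or> f s = g (cd_neg s)"
    using eq_or_neg_if_grade_eq[of "g s" n "f s"] assms by simp
  then show "f s \<in> g ` S"
    using s assms(1) by auto
qed

text \<open>
  The two sides of each normality condition are images of \<open>S\<close> under maps \<open>f\<close> and
  \<open>g\<close> that differ only in the order or the bracketing of a product.
\<close>

lemma image_eq_if_grade_eq: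
  assumes "cd_neg ` S \<subseteq> S"
    and "\<And>s. s \<in> S \<Longrightarrow> f s \<in> cd_carrier n"
    and "\<And>s. s \<in> S \<Longrightarrow> g s \<in> cd_carrier n"
    and "\<And>s. s \<in> S \<Longrightarrow> f (cd_neg s) = cd_neg (f s)"
    and "\<And>s. s \<in> S \<Longrightarrow> g (cd_neg s) = cd_neg (g s)"
    and "\<And>s. s \<in> S \<Longrightarrow> grade (f s) = grade (g s)"
  shows "f ` S = g ` S"
  using assms by (intro equalityI image_subset_if_grade_eq[of S _ n]) simp_all

lemma l_coset_eq_image: "x <#\<^bsub>G\<^esub> S = (\<lambda>s. x \<otimes>\<^bsub>G\<^esub> s) ` S"
  by (auto simp: l_coset_def)

lemma r_coset_eq_image: "S #>\<^bsub>G\<^esub> x = (\<lambda>s. s \<otimes>\<^bsub>G\<^esub> x) ` S"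
  by (auto simp: r_coset_def)

lemma subloop_normal:
  assumes subloop: "subloop S (cayley_dickson_loop n)"
  shows "normal_subloop S (cayley_dickson_loop n)"
proof -
  let ?Q = "cayley_dickson_loop n"
  have carrier: "carrier ?Q = cd_carrier n"
    by (simp add: cayley_dickson_loop_def)
  have mult: "x \<otimes>\<^bsub>?Q\<^esub> y = cd_mult x y" for x y
    by (simp add: cayley_dickson_loop_def)
  have sub: "s \<in> cd_carrier n" if "s \<in> S" for s
    using subloop that carrier by (auto simp: subloop_def)
  have "x <#\<^bsub>?Q\<^esub> S = S #>\<^bsub>?Q\<^esub> x \<and>
      (x <#\<^bsub>?Q\<^esub> S) #>\<^bsub>?Q\<^esub> y = x <#\<^bsub>?Q\<^esub> (S #>\<^bsub>?Q\<^esub> y) \<and>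
      x <#\<^bsub>?Q\<^esub> (y <#\<^bsub>?Q\<^esub> S) = (x \<otimes>\<^bsub>?Q\<^esub> y) <#\<^bsub>?Q\<^esub> S"
    if x: "x \<in> cd_carrier n" and y: "y \<in> cd_carrier n" for x y
    using subloop_trivial_or_neg_closed[OF subloop]
  proof
    assume "S = {cd_one n}"
    then show ?thesis
      using x y
      by (simp add: l_coset_eq_image r_coset_eq_image mult mult_closed mult_one)
  next
    assume neg: "cd_neg ` S \<subseteq> S"
    note facts = sub x y mult_closed neg_closed mult_neg[of _ n] grade_mult[of _ n]
    have "(\<lambda>s. cd_mult x s) ` S = (\<lambda>s. cd_mult s x) ` S"
      by (rule image_eq_if_grade_eq[OF neg, of _ n]) (simp_all add: facts xor_list_commute)
    moreover have "(\<lambda>s. cd_mult (cd_mult x s) y) ` S = (\<lambda>s. cd_mult x (cd_mult s y)) ` S"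
      by (rule image_eq_if_grade_eq[OF neg, of _ n]) (simp_all add: facts xor_list_assoc)
    moreover have "(\<lambda>s. cd_mult x (cd_mult y s)) ` S = (\<lambda>s. cd_mult (cd_mult x y) s) ` S"
      by (rule image_eq_if_grade_eq[OF neg, of _ n]) (simp_all add: facts xor_list_assoc)
    ultimately show ?thesis
      unfolding l_coset_eq_image r_coset_eq_image mult image_image by blast
  qed
  then show ?thesis
    unfolding normal_subloop_def carrier using subloop by blast
qed

theorem theorem25:
  fixes n :: nat
  shows "hamiltonian_loop (cayley_dickson_loop n)"
  by (simp add: hamiltonian_loop_def loop_cayley_dickson_loop subloop_normal)

end
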